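(* Let $k\geqslant 1$, $n\in\mathbb{Z}_{\geqslant 0}$, let $\overrightarrow{m}=(m_1,\ldots,m_k)$ be a multi-index of non-negative integers with $m=m_1+\ldots+m_k\neq 0$, and suppose that $n\geqslant\max\{m_j: 1\leqslant j\leqslant k\}$. Put $n_j=n+m-m_j$. Let $a^j_l$ ($1\leqslant j\leqslant k$, $l\geqslant 0$) be real numbers such that each series $\frac{a^j_0}{2}+\sum_{l=1}^\infty a^j_l T_l(x)$, where $T_l(x)=\cos(l\arccos x)$, converges for all $x\in[-1,1]$. Consider the associated systems ${\bf f^1}=(f^1_1,\ldots,f^1_k)$ and ${\bf f^{t1}}=(f^{t1}_1,\ldots,f^{t1}_k)$ of power and trigonometric series $$f^1_j(z)=\frac{a^j_0}{2}+\sum_{l=1}^\infty a^j_l z^l,\qquad f^{t1}_j(x)=\frac{a^j_0}{2}+\sum_{l=1}^\infty a^j_l\cos lx .$$ Then for the existence of trigonometric Hermite--Jacobi approximations $\{\widehat{\pi}^t_j(x;{\bf f^{t1}})\}_{j=1}^k$ for the multi-index $(n,\overrightarrow{m})$ and the system ${\bf f^{t1}}$ it is sufficient that the following conditions hold: 1) there exist (algebraic) Hermite--Jacobi approximations $\widehat{\pi}_j(z;{\bf f^1})=\widehat{P}_j(z;{\bf f^1})/\widehat{Q}_m(z;{\bf f^1})$, $j=1,\ldots,k$, for the multi-index $(n,\overrightarrow{m})$ and the system ${\bf f^1}$; 2) each power series $f^1_j$ has radius of convergence $R^1_j>1$; 3) the rational fractions $\widehat{\pi}_j(z;{\bf f^1})$,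 $j=1,\ldots,k$, have no poles in $\overline{D}=\{z:|z|\leqslant 1\}$. Moreover, if conditions 1)--3) are satisfied, then, with the appropriate normalization, the denominator $\widehat{Q}^t_m$ and numerators $\widehat{P}^t_j$ of the trigonometric Hermite--Jacobi approximations $\widehat{\pi}^t_j=\widehat{P}^t_j/\widehat{Q}^t_m$ satisfy, for all $j=1,\ldots,k$, $$\widehat{Q}^t_m(x;{\bf f^{t1}})=\widehat{Q}_m(e^{ix};{\bf f^1})\cdot\overline{\widehat{Q}_m(e^{ix};{\bf f^1})}=\sum_{l=0}^m q_l\cos lx,$$ $$\widehat{P}^t_j(x;{\bf f^{t1}})=\mathrm{Re}\left\{\widehat{P}_j(e^{ix};{\bf f^1})\cdot\overline{\widehat{Q}_m(e^{ix};{\bf f^1})}\right\}=\sum_{l=0}^{n_j}p^j_l\cos lx,$$ $$f^{t1}_j(x)-\widehat{\pi}^t_j(x;{\bf f^{t1}})=\sum_{l=n+m+1}^\infty d^j_l\cos lx,$$ where $q_l$, $p^j_l$, $d^j_l$ are real numbers.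
   Context: Throughout, $O(z^p)$ denotes a power series of the form $c_1z^p+c_2z^{p+1}+\ldots$, and $n_j=n+m-m_j$ with $m=m_1+\ldots+m_k$. (Algebraic) Hermite--Jacobi approximations. For a system ${\bf f}=(f_1,\ldots,f_k)$ of power series in $z$, rational functions $\widehat{\pi}_j(z;{\bf f})=\widehat{P}_j(z;{\bf f})/\widehat{Q}_m(z;{\bf f})$, $j=1,\ldots,k$, with a common denominator, where $\widehat{Q}_m$ (not identically zero) and $\widehat{P}_j$ are algebraic polynomials of degree at most $m$ and $n_j$ respectively, are called Hermite--Jacobi approximations for the multi-index $(n,\overrightarrow{m})$ and the system ${\bf f}$ if $f_j(z)-\widehat{P}_j(z;{\bf f})/\widehat{Q}_m(z;{\bf f})=O(z^{n+m+1})$ for $j=1,\ldots,k$. They may fail to exist. When the coefficients of the series are real, the polynomials $\widehat{Q}_m,\widehat{P}_j$ are taken with real coefficients. Trigonometric Hermite--Jacobi approximations. For a system ${\bf f^t}=(f^t_1,\ldots,f^t_k)$ of trigonometric series with real coefficients convergent for all $x\in\mathbb{R}$, trigonometric rational functions $\widehat{\pi}^t_j(x;{\bf f^t})=\widehat{P}^t_j(x;{\bf f^t})/\widehat{Q}^t_m(x;{\bf f^t})$, $j=1,\ldots,k$, with a common denominator, where $\widehat{Q}^t_m$ (not identically zero) and $\widehat{P}^t_j$ are trigonometric polynomials of degree at most $m$ and $n_j$ respectively, are called trigonometric Hermite--Jacobi approximations for the multi-index $(n,\overrightarrow{m})$ and the system ${\bf f^t}$ if $$f^t_j(x)-\frac{\widehat{P}^t_j(x;{\bf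 f^t})}{\widehat{Q}^t_m(x;{\bf f^t})}=\sum_{l=n+m+1}^\infty(\widehat{a}^j_l\cos lx+\widehat{b}^j_l\sin lx),\quad j=1,\ldots,k.$$ Quotients are regarded as (trigonometric) rational functions, i.e. removable singularities are removed. *)

theory Defs
  imports "HOL-Complex_Analysis.Complex_Analysis" "HOL-Computational_Algebra.Computational_Algebra"
begin

text \<open>
  Systems are indexed by \<open>j \<in> {1..k}\<close>; values at other indices are irrelevant.
  A multi-index is a function \<open>m\<close>, of total order \<open>mi_order k m\<close>.
\<close>

definition mi_order :: "nat \<Rightarrow> (nat \<Rightarrow> nat) \<Rightarrow> nat" where
  "mi_order k m = (\<Sum>j=1..k. m j)"

text \<open>The subtraction does not truncate, as \<open>m j \<le> mi_order k m\<close> for \<open>j \<in> {1..k}\<close>.\<close>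

definition num_deg :: "nat \<Rightarrow> nat \<Rightarrow> (nat \<Rightarrow> nat) \<Rightarrow> nat \<Rightarrow> nat" where
  "num_deg k n m j = n + mi_order k m - m j"

definition cheb_T :: "nat \<Rightarrow> real \<Rightarrow> real" where
  "cheb_T l x = cos (real l * arccos x)"

definition assoc_fps :: "(nat \<Rightarrow> real) \<Rightarrow> real fps" where
  "assoc_fps a = Abs_fps (\<lambda>l. if l = 0 then a 0 / 2 else a l)"

definition assoc_cos_series :: "(nat \<Rightarrow> real) \<Rightarrow> real \<Rightarrow> real" where
  "assoc_cos_series a x = a 0 / 2 + (\<Sum>l. a (Suc l) * cos (real (Suc l) * x))"

text \<open>
  The quotient is formed in the field of formal Laurent series, i.e. it is the expansion at 0 of
  the rational function \<open>P j / Q\<close> after cancellation; \<open>Q\<close> may vanish at 0. Division of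
  formal power series would be wrong here, since it discards the principal part.
\<close>

definition alg_HJ_approx ::
  "nat \<Rightarrow> nat \<Rightarrow> (nat \<Rightarrow> nat) \<Rightarrow> (nat \<Rightarrow> 'a::field fps) \<Rightarrow> (nat \<Rightarrow> 'a poly) \<Rightarrow> 'a poly \<Rightarrow> bool" where
  "alg_HJ_approx k n m f P Q \<longleftrightarrow>
     Q \<noteq> 0 \<and> degree Q \<le> mi_order k m \<and>
     (\<forall>j\<in>{1..k}. degree (P j) \<le> num_deg k n m j \<and>
        (\<exists>g. fps_to_fls (f j) - fps_to_fls (fps_of_poly (P j)) / fps_to_fls (fps_of_poly Q)
              = fps_to_fls (fps_X ^ (n + mi_order k m + 1) * g)))"

definition trig_poly :: "nat \<Rightarrow> (real \<Rightarrow> real) \<Rightarrow> bool" where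
  "trig_poly d T \<longleftrightarrow>
     (\<exists>\<alpha> \<beta>. \<forall>x. T x = (\<Sum>l=0..d. \<alpha> l * cos (real l * x) + \<beta> l * sin (real l * x)))"

text \<open>
  The quotient of two trigonometric polynomials with removable singularities removed.
  Away from the zeros of \<open>Q\<close> this is \<open>P x / Q x\<close> by continuity; it is meaningful only where
  the limit exists.
\<close>

definition trig_quot :: "(real \<Rightarrow> real) \<Rightarrow> (real \<Rightarrow> real) \<Rightarrow> real \<Rightarrow> real" where
  "trig_quot P Q x = Lim (at x) (\<lambda>t. P t / Q t)"

text \<open>Here \<open>f j\<close> is the sum function of the \<open>j\<close>-th (everywhere convergent) trigonometric series.\<close>

definition trig_HJ_approx ::
  "nat \<Rightarrow> nat \<Rightarrow> (nat \<Rightarrow> nat) \<Rightarrow> (nat \<Rightarrow> real \<Rightarrow> real) \<Rightarrow> (nat \<Rightarrow> real \<Rightarrow> real) \<Rightarrow> (real \<Rightarrow> real) \<Rightarrow> bool" where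
  "trig_HJ_approx k n m f P Q \<longleftrightarrow>
     (\<exists>x. Q x \<noteq> 0) \<and> trig_poly (mi_order k m) Q \<and>
     (\<forall>j\<in>{1..k}. trig_poly (num_deg k n m j) (P j) \<and>
        (\<exists>\<alpha> \<beta>. \<forall>x. (\<exists>c. ((\<lambda>t. P j t / Q t) \<longlongrightarrow> c) (at x)) \<and>
           (\<lambda>i. let l = n + mi_order k m + 1 + i in
                \<alpha> l * cos (real l * x) + \<beta> l * sin (real l * x))
             sums (f j x - trig_quot (P j) Q x)))"

abbreviation cpoly :: "real poly \<Rightarrow> complex \<Rightarrow> complex" where
  "cpoly p \<equiv> poly (map_poly complex_of_real p)"

end

theory Submission
  imports Defs "HOL-Computational_Algebra.Field_as_Ring"
begin

text \<open>
  Write \<open>N = n + mi_order k m + 1\<close> and \<open>f j\<close> for the associated power series. The algebraic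
  approximation property provides a formal power series \<open>h j\<close>, the expansion of \<open>P j / Q\<close> at 0,
  such that \<open>Q * h j = P j\<close> and \<open>f j - h j\<close> has no coefficients below \<open>N\<close>
  (\<open>alg_HJ_approx_imp_fps_mult\<close>). As \<open>P j / Q\<close> has no poles in the closed unit disc, \<open>h j\<close>
  converges in a disc of radius larger than 1 (\<open>fps_conv_radius_gt_1_if_no_poles\<close>); \<open>f j\<close> does
  so by assumption. So \<open>f j - h j\<close> may be evaluated at the points \<open>cis x\<close> of the unit circle.
  All coefficients being real, the real part of its value there is a cosine series starting at
  order \<open>N\<close>, and the real part of \<open>f j\<close> at \<open>cis x\<close> is the sum \<open>assoc_cos_series (a j) x\<close>
  (\<open>assoc_cos_series_eq_Re_eval_fps\<close>).

  It remains to recognise the real part of \<open>h j\<close> on the circle as a quotient of cosine polynomials.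
  Away from the zeros of \<open>Q\<close> it is the real part of \<open>P j / Q = P j * cnj Q / (Q * cnj Q)\<close>, whose
  denominator is real; and the real part of a product \<open>p * cnj q\<close> on the circle is a cosine
  polynomial (\<open>Re_cpoly_mult_cnj_eq_cos_sum\<close>). A zero of \<open>Q\<close> on the circle has to be
  cancelled by \<open>P j\<close>, and there the continuity of \<open>h j\<close> gives the value of the quotient with its
  removable singularities removed (\<open>tendsto_Re_mult_cnj_quotient\<close>).

  The hypothesis \<open>n \<ge> m j\<close> bounds degrees: the real part of \<open>P j * cnj Q\<close> has degree at most
  the larger of \<open>num_deg k n m j\<close> and \<open>mi_order k m\<close>, and the former is the larger one precisely if
  \<open>n \<ge> m j\<close>.
\<close>

section \<open>Formal power series with real coefficients as complex series\<close>

definition complex_fps :: "real fps \<Rightarrow> complex fps" where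
  "complex_fps f = Abs_fps (\<lambda>l. complex_of_real (fps_nth f l))"

lemma complex_fps_nth [simp]: "fps_nth (complex_fps f) l = of_real (fps_nth f l)"
  by (simp add: complex_fps_def)

lemma complex_fps_mult: "complex_fps (f * g) = complex_fps f * complex_fps g"
  by (rule fps_ext) (simp add: fps_mult_nth)

lemma complex_fps_diff: "complex_fps (f - g) = complex_fps f - complex_fps g"
  by (rule fps_ext) simp

lemma complex_fps_of_poly:
  "complex_fps (fps_of_poly p) = fps_of_poly (map_poly complex_of_real p)"
  by (rule fps_ext) (simp add: coeff_map_poly)

lemma fps_conv_radius_complex_fps [simp]: "fps_conv_radius (complex_fps f) = fps_conv_radius f"
proof -
  have "Abs_fps (\<lambda>l. norm (fps_nth (complex_fps f) l)) = Abs_fps (\<lambda>l. norm (fps_nth f l))"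
    by simp
  then show ?thesis
    by (metis fps_conv_radius_norm)
qed

lemma sums_Re_eval_complex_fps:
  assumes "fps_conv_radius f > 1"
  shows "(\<lambda>l. fps_nth f l * cos (real l * x)) sums Re (eval_fps (complex_fps f) (cis x))"
proof -
  have "(\<lambda>l. fps_nth (complex_fps f) l * cis x ^ l) sums eval_fps (complex_fps f) (cis x)"
    by (rule sums_eval_fps) (use assms in \<open>simp add: one_ereal_def\<close>)
  then have "(\<lambda>l. Re (fps_nth (complex_fps f) l * cis x ^ l)) sums Re (eval_fps (complex_fps f) (cis x))"
    by (rule sums_Re)
  moreover have "Re (fps_nth (complex_fps f) l * cis x ^ l) = fps_nth f l * cos (real l * x)" for l
    unfolding Complex.DeMoivre by simp
  ultimately show ?thesis by (simp only:)
qed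

lemma assoc_cos_series_eq_Re_eval_fps:
  assumes "fps_conv_radius (assoc_fps a) > 1"
  shows "assoc_cos_series a x = Re (eval_fps (complex_fps (assoc_fps a)) (cis x))"
proof -
  let ?c = "\<lambda>l. fps_nth (assoc_fps a) l * cos (real l * x)"
  have sums: "?c sums Re (eval_fps (complex_fps (assoc_fps a)) (cis x))"
    by (rule sums_Re_eval_complex_fps) (rule assms)
  then have "suminf ?c = ?c 0 + (\<Sum>l. ?c (Suc l))"
    using suminf_split_head[OF sums_summable[OF sums]] by simp
  with sums show ?thesis
    by (simp add: sums_iff assoc_cos_series_def assoc_fps_def)
qed

section \<open>Cosine polynomials from algebraic polynomials on the unit circle\<close>

text \<open>
  In the expanded product the coefficients of degrees \<open>i\<close> and \<open>r\<close> meet with the factor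
  \<open>cis ((i - r) * x)\<close>. The cosine is even, so its real part depends only on the distance of \<open>i\<close>
  and \<open>r\<close>, which is at most \<open>d\<close>, and not \<open>2 * d\<close>; collect the terms by this distance.
\<close>

lemma Re_cpoly_mult_cnj_eq_cos_sum:
  assumes "degree p \<le> d" and "degree q \<le> d"
  shows "\<exists>c. \<forall>x. Re (cpoly p (cis x) * cnj (cpoly q (cis x))) = (\<Sum>l=0..d. c l * cos (real l * x))"
proof -
  define dist where "dist = (\<lambda>(i, r). nat \<bar>int i - int r\<bar>)"
  define S where "S = {..d} \<times> {..d}"
  define c where "c l = (\<Sum>(i, r)\<in>{s \<in> S. dist s = l}. coeff p i * coeff q r)" for l
  have cpoly_cis: "cpoly s (cis x) = (\<Sum>i\<le>d. of_real (coeff s i) * cis (real i * x))"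
    if "degree s \<le> d" for s x
    unfolding poly_altdef Complex.DeMoivre
    using that by (intro sum.mono_neutral_cong_left)
      (auto simp: coeff_map_poly degree_map_poly coeff_eq_0)
  have "Re (cpoly p (cis x) * cnj (cpoly q (cis x))) = (\<Sum>l=0..d. c l * cos (real l * x))" for x
  proof -
    have "cpoly p (cis x) * cnj (cpoly q (cis x)) =
        (\<Sum>(i, r)\<in>S. of_real (coeff p i) * cis (real i * x) * cnj (of_real (coeff q r) * cis (real r * x)))"
      by (simp only: cpoly_cis[OF assms(1)] cpoly_cis[OF assms(2)] sum_product cnj_sum S_def
          sum.cartesian_product)
    also have "\<dots> = (\<Sum>(i, r)\<in>S. of_real (coeff p i * coeff q r) * cis (real i * x - real r * x))"
    proof (intro sum.cong refl, clarify)
      fix i r :: nat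
      have "cis (real i * x - real r * x) = cis (real i * x) * cnj (cis (real r * x))"
        by (simp add: cis_cnj cis_mult)
      then show "of_real (coeff p i) * cis (real i * x) * cnj (of_real (coeff q r) * cis (real r * x)) =
          of_real (coeff p i * coeff q r) * cis (real i * x - real r * x)"
        by (simp only: complex_cnj_mult complex_cnj_complex_of_real of_real_mult mult_ac)
    qed
    also have "Re \<dots> = (\<Sum>s\<in>S. coeff p (fst s) * coeff q (snd s) * cos (real (dist s) * x))"
      unfolding Re_sum
    proof (intro sum.cong refl)
      fix s assume "s \<in> S"
      obtain i r where s: "s = (i, r)" by force
      have "cos (real i * x - real r * x) = cos (real (dist s) * x)"
        unfolding s dist_def prod.case
        by (cases "r \<le> i") (simp_all add: of_nat_diff left_diff_distrib cos_diff)
      then show "Re (case s of (i, r) \<Rightarrow>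
          of_real (coeff p i * coeff q r) * cis (real i * x - real r * x)) =
        coeff p (fst s) * coeff q (snd s) * cos (real (dist s) * x)"
        by (simp add: s)
    qed
    also have "\<dots> = (\<Sum>l=0..d. \<Sum>s\<in>{s \<in> S. dist s = l}.
        coeff p (fst s) * coeff q (snd s) * cos (real (dist s) * x))"
      by (rule sum.group [symmetric]) (auto simp: S_def dist_def)
    also have "\<dots> = (\<Sum>l=0..d. c l * cos (real l * x))"
      by (intro sum.cong refl) (simp add: c_def sum_distrib_right case_prod_unfold)
    finally show ?thesis .
  qed
  then show ?thesis by blast
qed

lemma trig_poly_if_cos_sum:
  assumes "\<And>x. T x = (\<Sum>l=0..d. c l * cos (real l * x))"
  shows "trig_poly d T"
  unfolding trig_poly_def by (rule exI[of _ c], rule exI[of _ "\<lambda>_. 0"]) (simp add: assms)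

section \<open>Quotients of polynomials on the unit circle\<close>

text \<open>
  \<open>Q\<close> may well vanish in the disc. Cancelling the common factor of \<open>P\<close> and \<open>Q\<close> leaves a reduced
  fraction \<open>p / q\<close> with the same expansion \<open>h\<close>, and now every zero of \<open>q\<close> is a pole of
  \<open>P / Q\<close>. So the finitely many zeros of \<open>q\<close> all lie outside the closed disc, hence outside a
  larger disc, in which \<open>h\<close> converges.
\<close>

lemma fps_conv_radius_gt_1_if_no_poles:
  fixes P Q :: "complex poly" and h :: "complex fps"
  assumes Q: "Q \<noteq> 0" and h: "fps_of_poly Q * h = fps_of_poly P"
    and no_pole: "\<And>z. z \<in> cball 0 1 \<Longrightarrow> \<not> is_pole (\<lambda>w. poly P w / poly Q w) z"
  shows "fps_conv_radius h > 1"
proof -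
  define D where "D = gcd P Q"
  obtain p q where P_eq: "P = D * p" and Q_eq: "Q = D * q" and copr: "coprime p q"
  proof
    show "P = D * (P div D)" "Q = D * (Q div D)" by (simp_all add: D_def)
    show "coprime (P div D) (Q div D)"
      unfolding D_def by (rule div_gcd_coprime) (use Q in auto)
  qed
  have D: "D \<noteq> 0" and q: "q \<noteq> 0" using Q Q_eq by auto
  have h': "fps_of_poly q * h = fps_of_poly p"
    using h D by (simp add: P_eq Q_eq fps_of_poly_mult mult.assoc)
  have no_common_root: "poly p z \<noteq> 0" if "poly q z = 0" for z
  proof
    assume "poly p z = 0"
    with that have "[:-z, 1:] dvd p" "[:-z, 1:] dvd q" by (simp_all add: poly_eq_0_iff_dvd)
    with copr have "is_unit [:-z, 1:]" by (meson coprime_common_divisor)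
    then show False by (auto dest: is_unit_iff_degree[THEN iffD1, rotated])
  qed
  have q_nz: "poly q z \<noteq> 0" if "z \<in> cball 0 1" for z
  proof
    assume z: "poly q z = 0"
    have ev: "eventually (\<lambda>w. w \<notin> {w. poly Q w = 0}) (at z)"
      using islimpt_finite[OF poly_roots_finite[OF Q]] unfolding islimpt_iff_eventually by blast
    have "is_pole (\<lambda>w. poly p w / poly q w) z"
      unfolding is_pole_def
    proof (rule filterlim_divide_at_infinity)
      show "(poly p \<longlongrightarrow> poly p z) (at z)" by (intro tendsto_intros)
      have "(poly q \<longlongrightarrow> 0) (at z)" using tendsto_poly[OF tendsto_ident_at, of q z UNIV] z by simp
      then show "filterlim (poly q) (at 0) (at z)"
        using ev by (auto simp: filterlim_at Q_eq elim: eventually_mono)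
      show "poly p z \<noteq> 0" by (rule no_common_root) (rule z)
    qed
    also have "?this \<longleftrightarrow> is_pole (\<lambda>w. poly P w / poly Q w) z"
      by (intro is_pole_cong refl eventually_mono[OF ev]) (auto simp: P_eq Q_eq)
    finally show False using no_pole[OF that] by simp
  qed
  (* The element 2 serves the case that q has no zeros; every real number above 1 would do. *)
  define r where "r = Min (insert 2 (norm ` {z. poly q z = 0}))"
  have fin: "finite {z. poly q z = 0}" by (rule poly_roots_finite) (rule q)
  have r: "r > 1"
    unfolding r_def using fin q_nz by (subst Min_gr_iff) (auto simp: not_le[symmetric])
  have nz: "poly q z \<noteq> 0" if "norm z < r" for z
  proof
    assume "poly q z = 0"
    then have "r \<le> norm z" unfolding r_def using fin by (intro Min_le) auto
    with that show False by simp
  qed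
  have q0: "fps_of_poly q \<noteq> 0" using q by (metis fps_of_poly_0 fps_of_poly_eq_iff)
  have "h = fps_of_poly p / fps_of_poly q"
    using q0 by (simp flip: h')
  moreover have "fps_conv_radius (fps_of_poly p / fps_of_poly q) \<ge> ereal r"
    using fps_conv_radius_divide'[of "fps_of_poly p" "fps_of_poly q" "ereal r"] r nz by simp
  ultimately have "fps_conv_radius h \<ge> ereal r" by simp
  with r show ?thesis by (simp add: less_le_trans[of 1 "ereal r"])
qed

text \<open>
  The punctured neighbourhood matters if \<open>cis x\<close> itself lies in the finite set: \<open>cis\<close> does not
  return to the value \<open>cis x\<close> within less than a full turn.
\<close>

lemma eventually_cis_not_in_finite:
  assumes "finite Z"
  shows "eventually (\<lambda>t. cis t \<notin> Z) (at x)"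
proof -
  have "cis t \<noteq> cis x" if "t \<noteq> x" "dist t x < 2 * pi" for t
  proof
    assume "cis t = cis x"
    then have "sin t = sin x \<and> cos t = cos x" by (simp add: complex_eq_iff)
    then obtain i :: int where i: "t = x + 2 * pi * i" by (auto simp: sin_cos_eq_iff)
    with that have "i \<noteq> 0" "\<bar>real_of_int i\<bar> < 1" by (auto simp: dist_real_def abs_mult)
    then show False by linarith
  qed
  then have ne: "eventually (\<lambda>t. cis t \<noteq> cis x) (at x)"
    unfolding eventually_at by (intro exI[of _ "2 * pi"]) auto
  have "(cis \<longlongrightarrow> cis x) (at x)" by (intro tendsto_intros)
  with ne have "filterlim cis (at (cis x)) (at x)" by (simp add: filterlim_at)
  moreover have "eventually (\<lambda>w. w \<notin> Z) (at (cis x))"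
    using islimpt_finite[OF assms] unfolding islimpt_iff_eventually by blast
  ultimately show ?thesis by (rule filterlim_iff[THEN iffD1, rule_format])
qed

lemma eventually_poly_cis_nonzero:
  assumes "Q \<noteq> 0"
  shows "eventually (\<lambda>t. poly Q (cis t) \<noteq> 0) (at x)"
  using eventually_cis_not_in_finite[OF poly_roots_finite[OF assms]] by simp

text \<open>
  Near \<open>x\<close>, but not necessarily at \<open>x\<close>, the quotient equals the real part of
  \<open>eval_fps h (cis t)\<close>, which is continuous. So a zero of \<open>Q\<close> at \<open>cis x\<close> does no harm.
\<close>

lemma tendsto_Re_mult_cnj_quotient:
  fixes P Q :: "complex poly"
  assumes Q: "Q \<noteq> 0" and h: "fps_of_poly Q * h = fps_of_poly P" and radius: "fps_conv_radius h > 1"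
  shows "((\<lambda>t. Re (poly P (cis t) * cnj (poly Q (cis t))) / (norm (poly Q (cis t)))\<^sup>2)
            \<longlongrightarrow> Re (eval_fps h (cis x))) (at x)"
proof -
  have "((\<lambda>t. eval_fps h (cis t)) \<longlongrightarrow> eval_fps h (cis x)) (at x)"
    using radius by (intro isCont_tendsto_compose[of _ "eval_fps h"] continuous_eval_fps)
      (auto intro!: tendsto_intros simp: one_ereal_def)
  then have "((\<lambda>t. Re (eval_fps h (cis t))) \<longlongrightarrow> Re (eval_fps h (cis x))) (at x)"
    by (rule tendsto_Re)
  moreover have "eventually (\<lambda>t. Re (eval_fps h (cis t)) =
      Re (poly P (cis t) * cnj (poly Q (cis t))) / (norm (poly Q (cis t)))\<^sup>2) (at x)"
    using eventually_poly_cis_nonzero[OF Q]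
  proof eventually_elim
    case (elim t)
    have "poly Q (cis t) * eval_fps h (cis t) = poly P (cis t)"
      using eval_fps_mult[of "cis t" "fps_of_poly Q" h] radius by (simp add: h one_ereal_def)
    then have "eval_fps h (cis t) = poly P (cis t) / poly Q (cis t)"
      using elim by (simp add: field_simps)
    also have "\<dots> = poly P (cis t) * cnj (poly Q (cis t)) / of_real ((norm (poly Q (cis t)))\<^sup>2)"
      by (simp add: complex_div_cnj[of "poly P (cis t)"])
    finally show ?case by (simp only: Re_divide_of_real)
  qed
  ultimately show ?thesis by (rule Lim_transform_eventually)
qed

section \<open>From algebraic to trigonometric approximations\<close>

text \<open>
  The approximation property is an equation of Laurent series, but as \<open>f j\<close> and the remainder are
  power series, so is the expansion of \<open>P j / Q\<close>: it is the power series \<open>h\<close>. Multiplied by \<open>Q\<close>,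
  the property becomes an equation of power series.
\<close>

lemma alg_HJ_approx_imp_fps_mult:
  assumes "alg_HJ_approx k n m f P Q" and "j \<in> {1..k}"
  obtains h where "fps_of_poly Q * h = fps_of_poly (P j)"
    and "\<And>l. l < n + mi_order k m + 1 \<Longrightarrow> fps_nth (f j - h) l = 0"
proof -
  let ?N = "n + mi_order k m + 1"
  from assms obtain g where Q: "Q \<noteq> 0" and g: "fps_to_fls (f j) -
      fps_to_fls (fps_of_poly (P j)) / fps_to_fls (fps_of_poly Q) = fps_to_fls (fps_X ^ ?N * g)"
    unfolding alg_HJ_approx_def by blast
  let ?h = "f j - fps_X ^ ?N * g"
  have "fps_to_fls (fps_of_poly Q) \<noteq> 0"
    using Q by (metis fps_of_poly_0 fps_of_poly_eq_iff fps_to_fls_eq_0_iff)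
  moreover have "fps_to_fls ?h = fps_to_fls (fps_of_poly (P j)) / fps_to_fls (fps_of_poly Q)"
    unfolding fps_to_fls_minus g[symmetric] by simp
  ultimately have "fps_to_fls (fps_of_poly Q * ?h) = fps_to_fls (fps_of_poly (P j))"
    by (simp only: fls_times_fps_to_fls) simp
  then have "fps_of_poly Q * ?h = fps_of_poly (P j)" by (simp only: fps_to_fls_eq_iff)
  moreover have "fps_nth (f j - ?h) l = 0" if "l < ?N" for l
    using that by (simp add: fps_X_power_mult_nth del: power_Suc)
  ultimately show thesis by (rule that)
qed

theorem theorem1:
  fixes k n :: nat and m :: "nat \<Rightarrow> nat" and a :: "nat \<Rightarrow> nat \<Rightarrow> real"
    and P :: "nat \<Rightarrow> real poly" and Q :: "real poly"
  assumes "k \<ge> 1" and "mi_order k m \<noteq> 0" and "n \<ge> Max (m ` {1..k})"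
    and "\<forall>j\<in>{1..k}. \<forall>x\<in>{-1..1}. summable (\<lambda>l. a j (Suc l) * cheb_T (Suc l) x)"
    and "alg_HJ_approx k n m (\<lambda>j. assoc_fps (a j)) P Q"
    and "\<forall>j\<in>{1..k}. fps_conv_radius (assoc_fps (a j)) > 1"
    and "\<forall>j\<in>{1..k}. \<forall>z\<in>cball 0 1. \<not> is_pole (\<lambda>w. cpoly (P j) w / cpoly Q w) z"
  shows "\<exists>Pt Qt. trig_HJ_approx k n m (\<lambda>j. assoc_cos_series (a j)) Pt Qt \<and>
    (\<forall>x. complex_of_real (Qt x) = cpoly Q (cis x) * cnj (cpoly Q (cis x))) \<and>
    (\<exists>q :: nat \<Rightarrow> real. \<forall>x. Qt x = (\<Sum>l=0..mi_order k m. q l * cos (real l * x))) \<and>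
    (\<forall>j\<in>{1..k}.
      (\<forall>x. Pt j x = Re (cpoly (P j) (cis x) * cnj (cpoly Q (cis x)))) \<and>
      (\<exists>p :: nat \<Rightarrow> real. \<forall>x. Pt j x = (\<Sum>l=0..num_deg k n m j. p l * cos (real l * x))) \<and>
      (\<exists>d :: nat \<Rightarrow> real. \<forall>x.
         (\<lambda>i. let l = n + mi_order k m + 1 + i in d l * cos (real l * x))
           sums (assoc_cos_series (a j) x - trig_quot (Pt j) Qt x)))"
proof -
  define N where "N = n + mi_order k m + 1"
  define Qt where "Qt x = (norm (cpoly Q (cis x)))\<^sup>2" for x
  define Pt where "Pt j x = Re (cpoly (P j) (cis x) * cnj (cpoly Q (cis x)))" for j x
  note approx = assms(5)
  have Q: "Q \<noteq> 0" "degree Q \<le> mi_order k m"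
    using approx unfolding alg_HJ_approx_def by auto
  have deg_P: "degree (P j) \<le> num_deg k n m j" if "j \<in> {1..k}" for j
    using approx that unfolding alg_HJ_approx_def by auto
  have cQ: "map_poly complex_of_real Q \<noteq> 0"
    using Q by (subst map_poly_eq_0_iff) auto

  have Qt: "complex_of_real (Qt x) = cpoly Q (cis x) * cnj (cpoly Q (cis x))" for x
    by (simp only: Qt_def complex_norm_square)
  have "Qt x = Re (cpoly Q (cis x) * cnj (cpoly Q (cis x)))" for x
    by (simp flip: Qt)
  then obtain q where q: "\<And>x. Qt x = (\<Sum>l=0..mi_order k m. q l * cos (real l * x))"
    using Re_cpoly_mult_cnj_eq_cos_sum[of Q "mi_order k m" Q] Q by auto
  have "eventually (\<lambda>t. cpoly Q (cis t) \<noteq> 0) (at 0)"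
    by (rule eventually_poly_cis_nonzero) (rule cQ)
  then have Qt_nz: "\<exists>x. Qt x \<noteq> 0"
    by (auto simp: Qt_def dest: eventually_happens)

  have Pt: "\<exists>p. \<forall>x. Pt j x = (\<Sum>l=0..num_deg k n m j. p l * cos (real l * x))"
    if j: "j \<in> {1..k}" for j
  proof -
    have "m j \<le> n" using assms(3) j by (meson Max_ge finite_atLeastAtMost finite_imageI imageI le_trans)
    then have "degree Q \<le> num_deg k n m j" using Q by (simp add: num_deg_def)
    then show ?thesis
      unfolding Pt_def using deg_P[OF j] by (intro Re_cpoly_mult_cnj_eq_cos_sum)
  qed

  (* Only cosines occur in the remainder; its coefficients d serve both the approximation property
     and the last formula of the theorem. *)
  have remainder: "\<exists>d. \<forall>x. (\<exists>c. ((\<lambda>t. Pt j t / Qt t) \<longlongrightarrow> c) (at x)) \<and>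
      (\<lambda>i. d (N + i) * cos (real (N + i) * x)) sums
        (assoc_cos_series (a j) x - trig_quot (Pt j) Qt x)"
    if j: "j \<in> {1..k}" for j
  proof -
    let ?f = "assoc_fps (a j)"
    obtain h where h: "fps_of_poly Q * h = fps_of_poly (P j)"
      and vanish: "\<And>l. l < N \<Longrightarrow> fps_nth (?f - h) l = 0"
      using alg_HJ_approx_imp_fps_mult[OF approx j] unfolding N_def by blast
    have ch: "fps_of_poly (map_poly complex_of_real Q) * complex_fps h =
        fps_of_poly (map_poly complex_of_real (P j))"
      using arg_cong[OF h, of complex_fps] by (simp add: complex_fps_mult complex_fps_of_poly)
    have radius_f: "fps_conv_radius ?f > 1" using assms(6) j by blast
    have radius_ch: "fps_conv_radius (complex_fps h) > 1"
      by (rule fps_conv_radius_gt_1_if_no_poles[OF cQ ch]) (use assms(7) j in blast)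
    have radius: "fps_conv_radius (?f - h) > 1"
      using fps_conv_radius_diff[of ?f h] radius_f radius_ch by (auto simp: min_def split: if_splits)
    have lim: "((\<lambda>t. Pt j t / Qt t) \<longlongrightarrow> Re (eval_fps (complex_fps h) (cis x))) (at x)" for x
      unfolding Pt_def Qt_def by (rule tendsto_Re_mult_cnj_quotient[OF cQ ch radius_ch])
    have "(\<lambda>i. fps_nth (?f - h) (N + i) * cos (real (N + i) * x)) sums
        (assoc_cos_series (a j) x - trig_quot (Pt j) Qt x)" for x
    proof -
      have "trig_quot (Pt j) Qt x = Re (eval_fps (complex_fps h) (cis x))"
        unfolding trig_quot_def by (rule tendsto_Lim[OF _ lim]) simp
      then have "assoc_cos_series (a j) x - trig_quot (Pt j) Qt x =
          Re (eval_fps (complex_fps (?f - h)) (cis x))"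
        using radius_f radius_ch
        by (simp add: assoc_cos_series_eq_Re_eval_fps complex_fps_diff eval_fps_diff one_ereal_def)
      moreover have "(\<lambda>i. fps_nth (?f - h) (i + N) * cos (real (i + N) * x)) sums
          Re (eval_fps (complex_fps (?f - h)) (cis x))"
        by (subst sums_zero_iff_shift[of N "\<lambda>i. fps_nth (?f - h) i * cos (real i * x)"])
           (simp_all only: vanish mult_zero_left sums_Re_eval_complex_fps[OF radius])
      ultimately show ?thesis by (simp only: add.commute)
    qed
    with lim show ?thesis by blast
  qed

  have "trig_HJ_approx k n m (\<lambda>j. assoc_cos_series (a j)) Pt Qt"
    unfolding trig_HJ_approx_def
  proof (intro conjI ballI)
    show "\<exists>x. Qt x \<noteq> 0" by (rule Qt_nz)
    show "trig_poly (mi_order k m) Qt" using q by (rule trig_poly_if_cos_sum)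
    fix j assume j: "j \<in> {1..k}"
    show "trig_poly (num_deg k n m j) (Pt j)" using Pt[OF j] trig_poly_if_cos_sum by blast
    from remainder[OF j] obtain d where
      "\<forall>x. (\<exists>c. ((\<lambda>t. Pt j t / Qt t) \<longlongrightarrow> c) (at x)) \<and>
        (\<lambda>i. d (N + i) * cos (real (N + i) * x)) sums
          (assoc_cos_series (a j) x - trig_quot (Pt j) Qt x)" by blast
    then show "\<exists>\<alpha> \<beta>. \<forall>x. (\<exists>c. ((\<lambda>t. Pt j t / Qt t) \<longlongrightarrow> c) (at x)) \<and>
        (\<lambda>i. let l = n + mi_order k m + 1 + i in
            \<alpha> l * cos (real l * x) + \<beta> l * sin (real l * x))
          sums (assoc_cos_series (a j) x - trig_quot (Pt j) Qt x)"
      by (intro exI[of _ d] exI[of _ "\<lambda>_. 0"]) (simp add: Let_def N_def)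
  qed
  moreover have "\<exists>d. \<forall>x. (\<lambda>i. let l = n + mi_order k m + 1 + i in d l * cos (real l * x))
      sums (assoc_cos_series (a j) x - trig_quot (Pt j) Qt x)" if "j \<in> {1..k}" for j
    using remainder[OF that] by (auto simp: Let_def N_def)
  ultimately show ?thesis
    using Qt q Pt by (intro exI[of _ Pt] exI[of _ Qt]) (auto simp: Pt_def)
qed

end
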